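(* Let $K$ be any field. The partitions which are universal with respect to $K$ are precisely those with no part greater than $2$, together with the partition $(3)$.
   Context: A partition of $n$ is a weakly decreasing finite sequence of positive integers (its parts) with sum $n$. For a partition $\lambda$ of $n$ and a field $K$, $N(\lambda)$ denotes the similarity class of nilpotent matrices in $\mathrm{Mat}_n(K)$ whose Jordan block sizes are the parts of $\lambda$. Two similarity classes commute over $K$ if they contain representatives over $K$ which commute. A partition $\lambda$ of $n$ is universal with respect to a field $K$ if $N(\lambda)$ commutes with $N(\mu)$ over $K$ for every partition $\mu$ of $n$. *)

theory Defs
  imports "Jordan_Normal_Form.Jordan_Normal_Form"
begin

definition is_partition :: "nat \<Rightarrow> nat list \<Rightarrow> bool" where
  "is_partition n lam \<longleftrightarrow> sorted_wrt (\<ge>) lam \<and> (\<forall>p\<in>set lam. 0 < p) \<and> sum_list lam = n"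

text \<open>A matrix is nilpotent with Jordan block sizes the parts of \<open>lam\<close> iff it is similar over the
  ground field to the direct sum of the corresponding Jordan blocks with eigenvalue 0.\<close>

definition nilpotent_class :: "nat list \<Rightarrow> 'a::field mat set" where
  "nilpotent_class lam =
    {A \<in> carrier_mat (sum_list lam) (sum_list lam). jordan_nf A (map (\<lambda>k. (k, 0)) lam)}"

definition classes_commute :: "'a::field mat set \<Rightarrow> 'a mat set \<Rightarrow> bool" where
  "classes_commute C D \<longleftrightarrow> (\<exists>A\<in>C. \<exists>B\<in>D. A * B = B * A)"

text \<open>The type token carries the field, which the partition itself does not determine.\<close>

definition universal :: "'a::field itself \<Rightarrow> nat \<Rightarrow> nat list \<Rightarrow> bool" where
  "universal K n lam \<longleftrightarrow> is_partition n lam \<and>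
    (\<forall>mu. is_partition n mu \<longrightarrow>
      classes_commute (nilpotent_class lam :: 'a mat set) (nilpotent_class mu))"

end

theory Submission
  imports Defs
begin

text \<open>Over any field, a matrix \<open>A\<close> of type \<open>(2\<^sup>a, 1\<^sup>b)\<close> commuting with a given nilpotent type is built from
  two kinds of pieces. On a single Jordan block \<open>J\<close> of size \<open>m\<close>, the powers \<open>J\<^sup>m\<^sup>-\<^sup>r\<close> with \<open>2 r \<le> m\<close> square to
  zero and have rank \<open>r\<close>. Two odd blocks, of sizes \<open>m = b + 2 h\<close> and \<open>b\<close>, are the module
  \<open>K[x, \<epsilon>] / (\<epsilon>\<^sup>2, x\<^sup>b\<^sup>+\<^sup>h - \<epsilon> x\<^sup>b)\<close>, which is free over \<open>K[\<epsilon>]\<close>; multiplication by \<open>\<epsilon>\<close> then has all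
  blocks of size 2, a rank that single blocks cannot reach.

  Conversely, suppose that a part of the partition is at least 3, so that \<open>B\<^sup>2 \<noteq> 0\<close> for \<open>B\<close> in its class.
  A part 1 exists iff some row vector \<open>f\<close> and column vector \<open>g\<close> satisfy \<open>f B = 0\<close>, \<open>B g = 0\<close> and
  \<open>f g \<noteq> 0\<close>. If a part is 1, then \<open>B\<close> does not commute with a single block of size \<open>n\<close>: such a \<open>B\<close> is a
  unit times \<open>J\<^sup>k\<close>, where \<open>2 k < n\<close> because \<open>B\<^sup>2 \<noteq> 0\<close>, and this forces \<open>f g = 0\<close>. If no part is 1 and
  \<open>n \<ge> 4\<close>, then \<open>B\<close> does not commute with the type \<open>(n - 1, 1)\<close>: explicit \<open>f\<close> and \<open>g\<close> have \<open>f g \<noteq> 0\<close>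
  except in one case, in which \<open>B\<^sup>2 = 0\<close>.\<close>

section \<open>Direct sums and reindexing of nilpotent Jordan matrices\<close>

definition direct_sum :: "'a::zero mat \<Rightarrow> 'a mat \<Rightarrow> 'a mat" where
  "direct_sum A B = four_block_mat A (0\<^sub>m (dim_row A) (dim_col B)) (0\<^sub>m (dim_row B) (dim_col A)) B"

definition nilpotent_jordan :: "nat list \<Rightarrow> 'a::{zero,one} mat" where
  "nilpotent_jordan ks = jordan_matrix (map (\<lambda>k. (k, 0)) ks)"

lemma direct_sum_carrier [simp]:
  "A \<in> carrier_mat p p \<Longrightarrow> B \<in> carrier_mat q q \<Longrightarrow> direct_sum A B \<in> carrier_mat (p + q) (p + q)"
  by (auto simp: direct_sum_def)

lemma direct_sum_mult:
  assumes "A \<in> carrier_mat p p" "B \<in> carrier_mat q q" "A' \<in> carrier_mat p p" "B' \<in> carrier_mat q q"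
  shows "direct_sum A B * direct_sum A' B' = direct_sum (A * A') (B * B' :: 'a::semiring_1 mat)"
  unfolding direct_sum_def using assms
  by (subst mult_four_block_mat[of _ p p _ q _ q _ _ p _ q]) auto

lemma direct_sum_add:
  assumes "A \<in> carrier_mat p p" "B \<in> carrier_mat q q" "A' \<in> carrier_mat p p" "B' \<in> carrier_mat q q"
  shows "direct_sum A B + direct_sum A' B' = direct_sum (A + A') (B + B' :: 'a::semiring_1 mat)"
  unfolding direct_sum_def using assms
  by (subst add_four_block_mat[of _ p p _ q _ q]) auto

lemma direct_sum_similar:
  assumes "similar_mat A A'" "similar_mat B B'"
  shows "similar_mat (direct_sum A B) (direct_sum A' B')"
proof -
  obtain p where p: "A \<in> carrier_mat p p" "A' \<in> carrier_mat p p"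
    using similar_matD[OF assms(1)] by auto
  obtain q where q: "B \<in> carrier_mat q q" "B' \<in> carrier_mat q q"
    using similar_matD[OF assms(2)] by auto
  show ?thesis
    using similar_mat_four_block_0_0[OF assms p(1) q(1)] p q by (simp add: direct_sum_def)
qed

lemma nilpotent_jordan_carrier [simp]:
  fixes ks
  defines "A \<equiv> nilpotent_jordan ks :: 'a::{zero,one} mat"
  shows "A \<in> carrier_mat (sum_list ks) (sum_list ks)" "dim_row A = sum_list ks" "dim_col A = sum_list ks"
proof -
  have "map fst (map (\<lambda>k. (k, 0 :: 'a)) ks) = ks"
    by (induct ks) auto
  then show "A \<in> carrier_mat (sum_list ks) (sum_list ks)"
    using jordan_matrix_carrier[of "map (\<lambda>k. (k, 0 :: 'a)) ks"] by (simp only: nilpotent_jordan_def A_def)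
  then show "dim_row A = sum_list ks" "dim_col A = sum_list ks"
    by auto
qed

lemma nilpotent_jordan_Nil [simp]: "nilpotent_jordan [] = 0\<^sub>m 0 0"
  by (auto simp: nilpotent_jordan_def jordan_matrix_def)

lemma nilpotent_jordan_Cons:
  "nilpotent_jordan (k # ks) = direct_sum (jordan_block k 0) (nilpotent_jordan ks)"
  by (simp add: nilpotent_jordan_def jordan_matrix_def direct_sum_def Let_def)

lemma nilpotent_jordan_singleton: "nilpotent_jordan [k] = jordan_block k 0"
  by (auto simp: nilpotent_jordan_def jordan_matrix_def intro!: eq_matI)

lemma nilpotent_jordan_append:
  "nilpotent_jordan (ks @ ls) = direct_sum (nilpotent_jordan ks) (nilpotent_jordan ls)"
  by (simp add: nilpotent_jordan_def jordan_matrix_def direct_sum_def diag_block_mat_append Let_def)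

text \<open>Beyond similarity, \<open>jordan_nf\<close> only excludes blocks of size 0, and
  positivity of the parts does that.\<close>

lemma nilpotent_class_iff:
  assumes "\<forall>k\<in>set ks. 0 < k"
  shows "A \<in> nilpotent_class ks \<longleftrightarrow> similar_mat A (nilpotent_jordan ks)"
proof
  assume A: "similar_mat A (nilpotent_jordan ks)"
  obtain n where "A \<in> carrier_mat n n" "nilpotent_jordan ks \<in> (carrier_mat n n :: 'a mat set)"
    using similar_matD[OF A] by auto
  moreover have "nilpotent_jordan ks \<in> (carrier_mat (sum_list ks) (sum_list ks) :: 'a mat set)" by simp
  ultimately have "A \<in> carrier_mat (sum_list ks) (sum_list ks)" by auto
  with A assms show "A \<in> nilpotent_class ks"
    by (auto simp: nilpotent_class_def jordan_nf_def nilpotent_jordan_def)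
qed (auto simp: nilpotent_class_def jordan_nf_def nilpotent_jordan_def)

section \<open>Similarity by intertwiners and by permutations of the basis\<close>

lemma similar_mat_via_intertwiner:
  assumes "A \<in> carrier_mat n n" "B \<in> carrier_mat n n" "P \<in> carrier_mat n n" "Q \<in> carrier_mat n n"
    and QP: "Q * P = (1\<^sub>m n :: 'a::field mat)" and AP: "A * P = P * B"
  shows "similar_mat A B"
proof (rule similar_matI[where P = P and Q = Q])
  show PQ: "P * Q = 1\<^sub>m n"
    using mat_mult_left_right_inverse[OF assms(4,3) QP] .
  have "A = A * (P * Q)" using PQ assms(1) by simp
  also have "\<dots> = A * P * Q" using assms(1,3,4) by (rule assoc_mult_mat[symmetric])
  also have "\<dots> = P * B * Q" by (simp only: AP)
  finally show "A = P * B * Q" .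
qed (use assms in auto)

lemma sum_delta_mult:
  "(\<Sum>k<n. (if k = a then 1 else 0) * g k) = (if a < n then g a else (0 :: 'a::semiring_1))" for a n :: nat
  by (simp add: if_distrib[of "\<lambda>x. x * _"] cong: if_cong)

lemma sum_mult_delta:
  "(\<Sum>k<n. g k * (if k = a then 1 else 0)) = (if a < n then g a else (0 :: 'a::semiring_1))" for a n :: nat
  by (simp add: if_distrib[of "\<lambda>x. _ * x"] cong: if_cong)

lemma similar_mat_reindex:
  fixes A :: "'a::field mat"
  assumes A: "A \<in> carrier_mat n n" and pi: "\<And>i. i < n \<Longrightarrow> \<pi> i < n" "inj_on \<pi> {..<n}"
  shows "similar_mat A (mat n n (\<lambda>(i, j). A $$ (\<pi> i, \<pi> j)))"
proof -
  define P where "P = (mat n n (\<lambda>(i, j). if i = \<pi> j then 1 else 0) :: 'a mat)"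
  define Q where "Q = (mat n n (\<lambda>(i, j). if j = \<pi> i then 1 else 0) :: 'a mat)"
  define B where "B = mat n n (\<lambda>(i, j). A $$ (\<pi> i, \<pi> j))"
  have c: "P \<in> carrier_mat n n" "Q \<in> carrier_mat n n" "B \<in> carrier_mat n n"
    by (auto simp: P_def Q_def B_def)
  have QP: "Q * P = 1\<^sub>m n"
  proof (rule eq_matI)
    fix i j assume "i < dim_row (1\<^sub>m n)" "j < dim_col (1\<^sub>m n)"
    then have ij: "i < n" "j < n" by auto
    then have "(Q * P) $$ (i, j) = (\<Sum>k<n. (if k = \<pi> i then 1 else 0) * (if k = \<pi> j then 1 else 0))"
      by (simp add: P_def Q_def scalar_prod_def atLeast0LessThan)
    also have "\<dots> = (if \<pi> i = \<pi> j then 1 else 0)" using pi ij by (simp add: sum_delta_mult)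
    also have "\<dots> = 1\<^sub>m n $$ (i, j)" using pi ij by (auto dest: inj_onD)
    finally show "(Q * P) $$ (i, j) = 1\<^sub>m n $$ (i, j)" .
  qed (auto simp: P_def Q_def)
  have PQ: "P * Q = 1\<^sub>m n"
    using mat_mult_left_right_inverse[OF c(2,1) QP] .
  have AP: "A * P = mat n n (\<lambda>(i, j). A $$ (i, \<pi> j))"
  proof (rule eq_matI)
    fix i j assume "i < dim_row (mat n n (\<lambda>(i, j). A $$ (i, \<pi> j)))" "j < dim_col (mat n n (\<lambda>(i, j). A $$ (i, \<pi> j)))"
    then have ij: "i < n" "j < n" by auto
    then have "(A * P) $$ (i, j) = (\<Sum>k<n. A $$ (i, k) * (if k = \<pi> j then 1 else 0))"
      using A by (simp add: P_def scalar_prod_def atLeast0LessThan)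
    then show "(A * P) $$ (i, j) = mat n n (\<lambda>(i, j). A $$ (i, \<pi> j)) $$ (i, j)"
      using pi ij by (simp add: sum_mult_delta)
  qed (use A in \<open>auto simp: P_def\<close>)
  have "Q * (A * P) = B"
  proof (rule eq_matI)
    fix i j assume "i < dim_row B" "j < dim_col B"
    then have ij: "i < n" "j < n" by (auto simp: B_def)
    then have "(Q * (A * P)) $$ (i, j) = (\<Sum>k<n. (if k = \<pi> i then 1 else 0) * A $$ (k, \<pi> j))"
      by (simp add: AP Q_def scalar_prod_def atLeast0LessThan)
    then show "(Q * (A * P)) $$ (i, j) = B $$ (i, j)"
      using pi ij by (simp add: sum_delta_mult B_def)
  qed (use A in \<open>auto simp: P_def Q_def B_def\<close>)
  then have "P * B = P * Q * (A * P)"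
    using A c by (simp add: assoc_mult_mat[of _ n n _ n _ n])
  then have "A * P = P * B" using PQ A c by simp
  then show ?thesis
    using similar_mat_via_intertwiner[OF A c(3,1,2) QP] by (simp add: B_def)
qed

text \<open>The reindexing rotates the basis cyclically by \<open>p\<close>.\<close>

lemma direct_sum_swap:
  fixes A :: "'a::field mat"
  assumes "A \<in> carrier_mat p p" "B \<in> carrier_mat q q"
  shows "similar_mat (direct_sum A B) (direct_sum B A)"
proof -
  define \<pi> where "\<pi> i = (if i < q then i + p else i - q)" for i
  have "similar_mat (direct_sum A B) (mat (p + q) (p + q) (\<lambda>(i, j). direct_sum A B $$ (\<pi> i, \<pi> j)))"
    using assms by (intro similar_mat_reindex) (auto simp: \<pi>_def inj_on_def split: if_splits)
  also have "mat (p + q) (p + q) (\<lambda>(i, j). direct_sum A B $$ (\<pi> i, \<pi> j)) = direct_sum B A"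
    using assms by (intro eq_matI) (auto simp: direct_sum_def \<pi>_def)
  finally show ?thesis .
qed

text \<open>Lets the order of the blocks be ignored. The induction hypothesis compares the tail with
  \<open>vs @ us\<close>, so a single swap of \<open>us\<close> with \<open>k # vs\<close>
  remains.\<close>

lemma nilpotent_jordan_mset:
  assumes "mset ks = mset ls"
  shows "similar_mat (nilpotent_jordan ks :: 'a::field mat) (nilpotent_jordan ls)"
  using assms
proof (induct ks arbitrary: ls)
  case Nil
  then show ?case by (auto intro: similar_mat_refl[of _ 0])
next
  case (Cons k ks)
  then have "k \<in> set ls" by (metis list.set_intros(1) mset_eq_setD)
  then obtain us vs where ls: "ls = us @ k # vs" by (meson split_list)
  have "similar_mat (nilpotent_jordan ks :: 'a mat) (nilpotent_jordan (vs @ us))"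
    using Cons by (simp add: ls)
  then have "similar_mat (nilpotent_jordan (k # ks) :: 'a mat) (nilpotent_jordan ((k # vs) @ us))"
    by (auto simp: nilpotent_jordan_Cons intro!: direct_sum_similar similar_mat_refl[of _ k])
  also have "similar_mat (nilpotent_jordan ((k # vs) @ us) :: 'a mat) (nilpotent_jordan ls)"
    unfolding nilpotent_jordan_append ls by (intro direct_sum_swap) auto
  finally (similar_mat_trans) show ?case .
qed

section \<open>Powers of a Jordan block as models of the types with parts 2 and 1\<close>

lemma nilpotent_jordan_twos_ones:
  "nilpotent_jordan (replicate r 2 @ replicate s 1) =
    mat (2 * r + s) (2 * r + s) (\<lambda>(i, j). if j = Suc i \<and> even i \<and> i < 2 * r then 1 else 0)"
proof (induct r)
  case 0
  show ?case
  proof (induct s)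
    case (Suc s)
    then show ?case
      by (auto simp: nilpotent_jordan_Cons direct_sum_def simp del: nilpotent_jordan_carrier(1) intro!: eq_matI)
  qed (auto intro!: eq_matI)
next
  case (Suc r)
  show ?case
    unfolding replicate_Suc append_Cons nilpotent_jordan_Cons Suc
  proof (rule eq_matI, goal_cases)
    case (1 i j)
    \<comment> \<open>The new block in front occupies the indices 0 and 1 and moves all others by
      two.\<close>
    have "k = 0 \<or> k = 1 \<or> (\<exists>k'. k = Suc (Suc k'))" for k :: nat
      by (metis One_nat_def not0_implies_Suc)
    from this[of i] this[of j] show ?case
      using 1 by (elim disjE exE) (simp_all add: direct_sum_def)
  qed (simp_all add: direct_sum_def)
qed

text \<open>For \<open>c = 1\<close> and \<open>p = q\<close> this is the power of the Jordan block
  with exponent \<open>d\<close>. A rectangular one intertwines the blocks of sizes \<open>p\<close>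
  and \<open>q\<close> when \<open>q \<le> p + d\<close>, and so serves as a homomorphism between
  them.\<close>

definition shift_mat :: "'a::semiring_1 \<Rightarrow> nat \<Rightarrow> nat \<Rightarrow> nat \<Rightarrow> 'a mat" where
  "shift_mat c p q d = mat p q (\<lambda>(i, j). if j = i + d then c else 0)"

lemma shift_mat_carrier [simp]:
  "shift_mat c p q d \<in> carrier_mat p q" "dim_row (shift_mat c p q d) = p" "dim_col (shift_mat c p q d) = q"
  by (auto simp: shift_mat_def)

lemma shift_mat_index [simp]:
  "i < p \<Longrightarrow> j < q \<Longrightarrow> shift_mat c p q d $$ (i, j) = (if j = i + d then c else 0)"
  by (simp add: shift_mat_def)

text \<open>The shift joins \<open>k\<close> to \<open>k + (r + s)\<close> for \<open>k < r\<close>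
  and does nothing else: this makes \<open>r\<close> pairs and leaves the \<open>s\<close> indices
  in the middle alone.\<close>

lemma shift_mat_similar:
  "similar_mat (shift_mat 1 (2 * r + s) (2 * r + s) (r + s) :: 'a::field mat)
    (nilpotent_jordan (replicate r 2 @ replicate s 1))"
proof -
  define n where "n = 2 * r + s"
  define A where "A = (shift_mat 1 n n (r + s) :: 'a mat)"
  \<comment> \<open>\<open>\<pi>\<close> lists the pairs one after the other and then the middle
    indices. Its left inverse \<open>\<sigma>\<close> yields injectivity.\<close>
  define \<pi> where "\<pi> k = (if k < 2 * r then if even k then k div 2 else k div 2 + (r + s) else k - r)" for k
  define \<sigma> where "\<sigma> k = (if k < r then 2 * k else if r + s \<le> k then Suc (2 * (k - (r + s))) else k + r)" for k
  have bound: "\<pi> k < n" if "k < n" for k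
    using that by (auto simp: \<pi>_def n_def)
  have low: "\<pi> (2 * k) = k" "\<pi> (Suc (2 * k)) = k + (r + s)" if "k < r" for k
    using that by (auto simp: \<pi>_def)
  have high: "\<pi> k = k - r" if "2 * r \<le> k" for k
    using that by (auto simp: \<pi>_def)
  have cases: "(\<exists>k<r. i = 2 * k) \<or> (\<exists>k<r. i = Suc (2 * k)) \<or> 2 * r \<le> i" for i
    by presburger
  have \<sigma>\<pi>: "\<sigma> (\<pi> k) = k" if "k < n" for k
    using cases[of k] that by (elim disjE exE conjE) (auto simp: low high \<sigma>_def n_def)
  have inj: "inj_on \<pi> {..<n}"
    by (rule inj_on_inverseI[of _ \<sigma>]) (simp add: \<sigma>\<pi>)
  have "similar_mat A (mat n n (\<lambda>(i, j). A $$ (\<pi> i, \<pi> j)))"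
    by (rule similar_mat_reindex[OF _ bound inj]) (auto simp: A_def)
  also have "mat n n (\<lambda>(i, j). A $$ (\<pi> i, \<pi> j)) = nilpotent_jordan (replicate r 2 @ replicate s 1)"
  proof -
    have "\<pi> j = \<pi> i + (r + s) \<longleftrightarrow> j = Suc i \<and> even i \<and> i < 2 * r" if "i < n" "j < n" for i j
      using cases[of i]
    proof (elim disjE exE conjE)
      fix k assume k: "k < r" "i = 2 * k"
      have "\<sigma> (k + (r + s)) = Suc (2 * k)" using k by (simp add: \<sigma>_def)
      then have "\<pi> j = k + (r + s) \<longleftrightarrow> j = Suc (2 * k)"
        using \<sigma>\<pi>[OF that(2)] low(2)[OF k(1)] by metis
      then show ?thesis using k by (simp add: low)
    next
      fix k assume k: "k < r" "i = Suc (2 * k)"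
      then show ?thesis using bound[OF that(2)] by (simp add: low n_def)
    next
      assume "2 * r \<le> i"
      then show ?thesis using bound[OF that(2)] by (simp add: high n_def)
    qed
    then show ?thesis
      unfolding nilpotent_jordan_twos_ones n_def[symmetric]
      by (intro eq_matI) (auto simp: A_def bound)
  qed
  finally show ?thesis by (simp add: A_def n_def)
qed

section \<open>Types with all parts at most 2 commute with every type\<close>

text \<open>Similarity alone, unlike membership in \<open>nilpotent_class\<close>, puts no
  positivity condition on the lists, which can then be cut and joined freely.\<close>

definition commuting_types :: "'a::field itself \<Rightarrow> nat list \<Rightarrow> nat list \<Rightarrow> bool" where
  "commuting_types K ks ls \<longleftrightarrow> (\<exists>A B :: 'a mat. similar_mat A (nilpotent_jordan ks) \<and>
    similar_mat B (nilpotent_jordan ls) \<and> A * B = B * A)"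

lemma classes_commute_iff:
  assumes "\<forall>k\<in>set ks. 0 < k" "\<forall>k\<in>set ls. 0 < k"
  shows "classes_commute (nilpotent_class ks :: 'a::field mat set) (nilpotent_class ls) \<longleftrightarrow>
    commuting_types TYPE('a) ks ls"
  unfolding classes_commute_def commuting_types_def Bex_def
    nilpotent_class_iff[OF assms(1)] nilpotent_class_iff[OF assms(2)] by blast

lemma commuting_types_mset:
  assumes "commuting_types K ks ls" "mset ks = mset ks'" "mset ls = mset ls'"
  shows "commuting_types K ks' ls'"
  using assms unfolding commuting_types_def by (meson nilpotent_jordan_mset similar_mat_trans)

lemma similar_mat_carrier:
  "similar_mat A B \<Longrightarrow> B \<in> carrier_mat n n \<Longrightarrow> A \<in> carrier_mat n n"
  using similar_matD by fastforce

text \<open>Direct sums of commuting pairs commute; the equal sums make the blocks of the two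
  matrices line up.\<close>

lemma commuting_types_append:
  assumes "commuting_types TYPE('a::field) ks ls" "commuting_types TYPE('a) ks' ls'"
    and sums: "sum_list ks = sum_list ls" "sum_list ks' = sum_list ls'"
  shows "commuting_types TYPE('a) (ks @ ks') (ls @ ls')"
proof -
  obtain A B :: "'a mat" where AB: "similar_mat A (nilpotent_jordan ks)"
    "similar_mat B (nilpotent_jordan ls)" "A * B = B * A"
    using assms(1) by (auto simp: commuting_types_def)
  obtain A' B' :: "'a mat" where AB': "similar_mat A' (nilpotent_jordan ks')"
    "similar_mat B' (nilpotent_jordan ls')" "A' * B' = B' * A'"
    using assms(2) by (auto simp: commuting_types_def)
  define p q where "p = sum_list ls" and "q = sum_list ls'"
  have "A \<in> carrier_mat p p" "B \<in> carrier_mat p p" "A' \<in> carrier_mat q q" "B' \<in> carrier_mat q q"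
    using similar_mat_carrier[OF AB(1) nilpotent_jordan_carrier(1)]
      similar_mat_carrier[OF AB(2) nilpotent_jordan_carrier(1)]
      similar_mat_carrier[OF AB'(1) nilpotent_jordan_carrier(1)]
      similar_mat_carrier[OF AB'(2) nilpotent_jordan_carrier(1)]
    by (simp_all add: p_def q_def sums)
  then have "direct_sum A A' * direct_sum B B' = direct_sum B B' * direct_sum A A'"
    using AB(3) AB'(3) by (simp add: direct_sum_mult[of _ p _ q])
  then show ?thesis
    unfolding commuting_types_def nilpotent_jordan_append
    using AB AB' by (blast intro: direct_sum_similar)
qed

section \<open>The two building blocks: one Jordan block, and two of equal parity\<close>

lemma shift_mat_mult:
  assumes "M \<in> carrier_mat q r"
  shows "shift_mat c p q d * M = mat p r (\<lambda>(i, j). if i + d < q then c * M $$ (i + d, j) else 0)"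
proof (rule eq_matI, goal_cases)
  case (1 i j)
  then have "(shift_mat c p q d * M) $$ (i, j) =
      (\<Sum>k<q. (if k = i + d then 1 else 0) * (c * M $$ (k, j)))"
    using assms by (auto simp: scalar_prod_def atLeast0LessThan intro!: sum.cong)
  with 1 show ?case by (simp add: sum_delta_mult)
qed (use assms in auto)

lemma nilpotent_jordan_single_shift: "nilpotent_jordan [m] = shift_mat 1 m m 1"
  by (intro eq_matI) (auto simp: nilpotent_jordan_singleton)

text \<open>Both matrices are powers of one Jordan block, with exponents \<open>r + s\<close> and
  1.\<close>

lemma commuting_types_single:
  "commuting_types TYPE('a::field) (replicate r 2 @ replicate s 1) [2 * r + s]"
proof -
  let ?n = "2 * r + s"
  let ?A = "shift_mat 1 ?n ?n (r + s) :: 'a mat" and ?B = "shift_mat 1 ?n ?n 1 :: 'a mat"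
  have "?A * ?B = ?B * ?A"
    by (subst (1 2) shift_mat_mult[of _ ?n ?n]) (auto intro!: eq_matI)
  moreover have "similar_mat ?B (nilpotent_jordan [?n])"
    unfolding nilpotent_jordan_single_shift
    by (rule similar_mat_refl[of _ ?n]) simp
  ultimately show ?thesis
    unfolding commuting_types_def using shift_mat_similar[of r s] by metis
qed

text \<open>In the module of the introduction, \<open>A\<close> below is the transposed matrix of multiplication by \<open>\<epsilon>\<close>
  in the basis \<open>x\<^sup>i\<close> (\<open>i < m\<close>), \<open>\<epsilon> x\<^sup>i - x\<^sup>i\<^sup>+\<^sup>h\<close> (\<open>i < b\<close>), in which multiplication by \<open>x\<close> is in Jordan form.\<close>

lemma commuting_types_pair:
  "commuting_types TYPE('a::field) (replicate (b + h) 2) [b + 2 * h, b]"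
proof -
  define m a where "m = b + 2 * h" and "a = b + h"
  let ?S = "shift_mat (1 :: 'a)" and ?N = "shift_mat (- 1 :: 'a)"
  \<comment> \<open>\<open>D\<close> records
    \<open>x\<^sup>k = \<epsilon> x\<^sup>k\<^sup>-\<^sup>h\<close> for
    \<open>a \<le> k < m\<close>, which follows from
    \<open>x\<^sup>b\<^sup>+\<^sup>h = \<epsilon> x\<^sup>b\<close>.\<close>
  define D :: "'a mat" where "D = mat m a (\<lambda>(k, j). if k = j + h \<and> b \<le> j then 1 else 0)"
  define A where "A = four_block_mat (?S m m h) (?S m b 0) (?N b m (2 * h)) (?N b b h)"
  \<comment> \<open>The rows of \<open>P\<close> expand the Jordan basis in the basis
    \<open>x\<^sup>j\<close>, \<open>\<epsilon> x\<^sup>j\<close> (\<open>j < a\<close>) that shows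
    freeness over \<open>K[\<epsilon>]\<close>; the rows of \<open>Q\<close> expand back. In the new
    basis, multiplication by \<epsilon> has the transposed matrix \<open>T\<close>.\<close>
  define P where "P = four_block_mat (?S m a 0) D (?N b a h) (?S b a 0)"
  define Q where "Q = four_block_mat (?S a m 0) (0\<^sub>m a b) (?S a m h) (?S a b 0)"
  define T :: "'a mat" where "T = four_block_mat (0\<^sub>m a a) (1\<^sub>m a) (0\<^sub>m a a) (0\<^sub>m a a)"
  define N where "N = four_block_mat (?S m m 1) (0\<^sub>m m b) (0\<^sub>m b m) (?S b b 1)"
  have D: "D \<in> carrier_mat m a" by (simp add: D_def)
  have mb: "m + b = 2 * a" by (simp add: m_def a_def)
  have "A \<in> carrier_mat (m + b) (m + b)" "T \<in> carrier_mat (a + a) (a + a)"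
    "P \<in> carrier_mat (m + b) (a + a)" "Q \<in> carrier_mat (a + a) (m + b)"
    unfolding A_def T_def P_def Q_def by (rule four_block_carrier_mat; simp)+
  then have carrier: "A \<in> carrier_mat (2 * a) (2 * a)" "T \<in> carrier_mat (2 * a) (2 * a)"
    "P \<in> carrier_mat (2 * a) (2 * a)" "Q \<in> carrier_mat (2 * a) (2 * a)"
    by (simp_all only: mb mult_2)
  have mh: "m = a + h" and ab: "a = b + h" by (simp_all add: m_def a_def)
  have D_index: "D $$ (k, j) = (if k = j + h \<and> b \<le> j then 1 else 0)" if "k < b + h + h" "j < b + h" for k j
    using that by (simp add: D_def mh ab)
  have "D \<in> carrier_mat (b + h + h) (b + h)"
    using D by (simp add: mh ab)
  note mult = shift_mat_mult[OF this] shift_mat_mult[OF shift_mat_carrier(1)]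
  have QP: "Q * P = 1\<^sub>m (2 * a)"
  proof -
    have "?S a m 0 * ?S m a 0 + 0\<^sub>m a b * ?N b a h = 1\<^sub>m a"
      by (rule eq_matI) (simp_all add: mult mh)
    moreover have "?S a m 0 * D + 0\<^sub>m a b * ?S b a 0 = 0\<^sub>m a a"
      by (rule eq_matI) (simp_all add: mult mh ab D_index)
    moreover have "?S a m h * ?S m a 0 + ?S a b 0 * ?N b a h = 0\<^sub>m a a"
      by (rule eq_matI) (simp_all add: mult mh ab)
    moreover have "?S a m h * D + ?S a b 0 * ?S b a 0 = 1\<^sub>m a"
      by (rule eq_matI) (simp_all add: mult mh ab D_index)
    ultimately show ?thesis
      unfolding Q_def P_def mult_2 four_block_one_mat[symmetric]
      using D by (subst mult_four_block_mat[of _ a m _ b _ a _ _ a _ a]) simp_all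
  qed
  have AP: "A * P = P * T"
  proof -
    have "?S m m h * ?S m a 0 + ?S m b 0 * ?N b a h = 0\<^sub>m m a"
      by (rule eq_matI) (simp_all add: mult mh ab)
    moreover have "?S m m h * D + ?S m b 0 * ?S b a 0 = ?S m a 0"
      by (rule eq_matI) (simp_all add: mult mh ab D_index)
    moreover have "?N b m (2 * h) * ?S m a 0 + ?N b b h * ?N b a h = 0\<^sub>m b a"
      by (rule eq_matI) (simp_all add: mult mh ab)
    moreover have "?N b m (2 * h) * D + ?N b b h * ?S b a 0 = ?N b a h"
      by (rule eq_matI) (simp_all add: mult mh ab D_index)
    ultimately have "A * P = four_block_mat (0\<^sub>m m a) (?S m a 0) (0\<^sub>m b a) (?N b a h)"
      unfolding A_def P_def
      using D by (subst mult_four_block_mat[of _ m m _ b _ b _ _ a _ a]) simp_all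
    also have "\<dots> = P * T"
      unfolding T_def P_def using D
      by (subst mult_four_block_mat[of _ m a _ a _ b _ _ a _ a]) auto
    finally show ?thesis .
  qed
  \<comment> \<open>The zeros match \<open>shift_mat_similar\<close> at \<open>s = 0\<close>: there
    are only blocks of size 2.\<close>
  have "T = ?S (2 * a + 0) (2 * a + 0) (a + 0)"
    by (rule eq_matI) (auto simp: T_def)
  then have "similar_mat A (nilpotent_jordan (replicate a 2 @ replicate 0 1))"
    using similar_mat_via_intertwiner[OF carrier QP AP] shift_mat_similar[of a 0, where 'a = 'a]
    by (metis similar_mat_trans)
  moreover have "similar_mat N (nilpotent_jordan [m, b])"
  proof -
    have "N = nilpotent_jordan ([m] @ [b])"
      unfolding nilpotent_jordan_append nilpotent_jordan_single_shift by (simp add: N_def direct_sum_def)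
    then show ?thesis
      by (metis append_Cons append_Nil nilpotent_jordan_carrier(1) similar_mat_refl)
  qed
  moreover have "A * N = N * A"
  proof -
    have "?S m m h * ?S m m 1 = ?S m m 1 * ?S m m h"
      by (rule eq_matI) (simp_all add: mult)
    moreover have "?S m b 0 * ?S b b 1 = ?S m m 1 * ?S m b 0"
      by (rule eq_matI) (simp_all add: mult mh ab)
    moreover have "?N b m (2 * h) * ?S m m 1 = ?S b b 1 * ?N b m (2 * h)"
      by (rule eq_matI) (simp_all add: mult mh ab)
    moreover have "?N b b h * ?S b b 1 = ?S b b 1 * ?N b b h"
      by (rule eq_matI) (simp_all add: mult)
    moreover have "?S m m 1 * ?S m m h \<in> carrier_mat m m" "?S m m 1 * ?S m b 0 \<in> carrier_mat m b"
      "?S b b 1 * ?N b m (2 * h) \<in> carrier_mat b m" "?S b b 1 * ?N b b h \<in> carrier_mat b b"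
      by (simp_all add: mult)
    ultimately show ?thesis
      unfolding A_def N_def
      by (subst (1 2) mult_four_block_mat[of _ m m _ b _ b _ _ m _ b]) simp_all
  qed
  ultimately show ?thesis
    unfolding commuting_types_def m_def a_def by auto
qed


section \<open>Assembling arbitrary types from the building blocks\<close>

lemma commuting_types_twos_ones_append:
  assumes "commuting_types TYPE('a::field) (replicate a 2 @ replicate b 1) ls" "2 * a + b = sum_list ls"
    and "commuting_types TYPE('a) (replicate a' 2 @ replicate b' 1) ls'" "2 * a' + b' = sum_list ls'"
  shows "commuting_types TYPE('a) (replicate (a + a') 2 @ replicate (b + b') 1) (ls @ ls')"
proof (rule commuting_types_mset)
  show "commuting_types TYPE('a) ((replicate a 2 @ replicate b 1) @ replicate a' 2 @ replicate b' 1) (ls @ ls')"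
    using assms by (intro commuting_types_append) (simp_all add: sum_list_replicate)
qed (simp_all add: replicate_add)

text \<open>Blocks of \<open>ls\<close> are used up one by one, each taking its share of twos and
  ones. Only an odd block with no ones left is a problem; parity then provides a second odd block,
  and the two together take twos only.\<close>

lemma commuting_types_twos_ones:
  assumes "2 * a + b = sum_list ls"
  shows "commuting_types TYPE('a::field) (replicate a 2 @ replicate b 1) ls"
  using assms
proof (induct "length ls" arbitrary: ls a b rule: less_induct)
  case less
  show ?case
  proof (cases ls)
    case Nil
    then show ?thesis
      using less.prems similar_mat_refl[of "0\<^sub>m 0 0 :: 'a mat" 0] by (auto simp: commuting_types_def)
  next
    case (Cons m rest)
    have sum: "2 * a + b = m + sum_list rest"
      using less.prems Cons by simp
    show ?thesis
    proof (cases "even m \<or> 0 < b")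
      case True
      \<comment> \<open>If the twos can cover \<open>m\<close>, as many as fit are taken, and a
        single 1 if \<open>m\<close> is odd; otherwise all twos are taken and ones fill the
        rest.\<close>
      obtain r s where rs: "2 * r + s = m" "r \<le> a" "s \<le> b"
      proof (cases "m \<le> 2 * a")
        case True
        with \<open>even m \<or> 0 < b\<close> have "2 * (m div 2) + m mod 2 = m \<and> m div 2 \<le> a \<and> m mod 2 \<le> b"
          by presburger
        then show ?thesis using that by blast
      next
        case False
        then show ?thesis using that[of a "m - 2 * a"] sum by auto
      qed
      have "commuting_types TYPE('a) (replicate (a - r) 2 @ replicate (b - s) 1) rest"
        using rs sum Cons by (intro less.hyps) auto
      then have "commuting_types TYPE('a) (replicate (r + (a - r)) 2 @ replicate (s + (b - s)) 1) ([m] @ rest)"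
        using rs sum commuting_types_single[of r s, where 'a = 'a]
        by (intro commuting_types_twos_ones_append) auto
      then show ?thesis using rs Cons by simp
    next
      case False
      then have m: "odd m" "b = 0" by auto
      \<comment> \<open>The total \<open>2 * a\<close> is even while \<open>m\<close> is
        odd.\<close>
      have "\<exists>m'\<in>set rest. odd m'"
      proof (rule ccontr)
        assume "\<not> (\<exists>m'\<in>set rest. odd m')"
        then have "even (sum_list rest)" by (induct rest) auto
        moreover have "odd (sum_list rest)" using sum m by presburger
        ultimately show False by simp
      qed
      then obtain m' where m': "m' \<in> set rest" "odd m'" by blast
      define c where "c = (m + m') div 2"
      have c: "2 * c = m + m'" using m m' by (auto simp: c_def)
      have rest: "sum_list rest = m' + sum_list (remove1 m' rest)"
        using m'(1) by (rule sum_list_map_remove1[where f = "\<lambda>x. x", simplified])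
      have pair: "commuting_types TYPE('a) (replicate c 2) [m, m']"
      proof (cases "m' \<le> m")
        case True
        then have "m = m' + 2 * (c - m')" "c = m' + (c - m')" using c by auto
        then show ?thesis using commuting_types_pair[of m' "c - m'", where 'a = 'a] by metis
      next
        case False
        then have "m' = m + 2 * (c - m)" "c = m + (c - m)" using c by auto
        then have "commuting_types TYPE('a) (replicate c 2) [m', m]"
          using commuting_types_pair[of m "c - m", where 'a = 'a] by metis
        then show ?thesis by (rule commuting_types_mset) auto
      qed
      have "commuting_types TYPE('a) (replicate (a - c) 2 @ replicate 0 1) (remove1 m' rest)"
        using c sum rest m m' Cons by (intro less.hyps) (auto simp: length_remove1)
      then have "commuting_types TYPE('a) (replicate (c + (a - c)) 2 @ replicate (0 + 0) 1) ([m, m'] @ remove1 m' rest)"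
        using pair c sum rest m by (intro commuting_types_twos_ones_append) auto
      moreover have "c + (a - c) = a" using c sum rest m by simp
      ultimately show ?thesis
        using m m' Cons by (auto intro: commuting_types_mset)
    qed
  qed
qed

section \<open>Similarity invariants\<close>

lemma similar_mat_intertwiners:
  fixes B J :: "'a::field mat"
  assumes "similar_mat B J" "J \<in> carrier_mat n n"
  obtains P Q where "B \<in> carrier_mat n n" "P \<in> carrier_mat n n" "Q \<in> carrier_mat n n"
    "P * Q = 1\<^sub>m n" "Q * P = 1\<^sub>m n" "Q * B = J * Q" "B * P = P * J"
proof -
  obtain n' P Q where c: "{B, J, P, Q} \<subseteq> carrier_mat n' n'"
    and PQ: "P * Q = 1\<^sub>m n'" and QP: "Q * P = 1\<^sub>m n'" and B: "B = P * J * Q"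
    using similar_matD[OF assms(1)] by blast
  have n': "n' = n" using c assms(2) by auto
  have cs: "B \<in> carrier_mat n n" "J \<in> carrier_mat n n" "P \<in> carrier_mat n n" "Q \<in> carrier_mat n n"
    using c unfolding n' by auto
  note assoc = assoc_mult_mat[of _ n n _ n _ n] mult_carrier_mat[of _ n n _ n]
  have "Q * B = (Q * P) * (J * Q)" using cs by (simp only: B assoc)
  then have "Q * B = J * Q" using cs QP by (simp add: n')
  moreover have "B * P = (P * J) * (Q * P)" using cs by (simp only: B assoc)
  then have "B * P = P * J" using cs QP by (simp add: n')
  ultimately show thesis
    using that cs PQ QP unfolding n' by blast
qed

text \<open>Simultaneous conjugation preserves commutation, so the second matrix may be taken to be
  the Jordan matrix itself.\<close>

lemma commuting_types_normalize:
  assumes "commuting_types TYPE('a::field) ks ls"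
  obtains A :: "'a::field mat" where "similar_mat A (nilpotent_jordan ks)"
    "A * nilpotent_jordan ls = nilpotent_jordan ls * A"
proof -
  obtain A B :: "'a mat" where AB: "similar_mat A (nilpotent_jordan ks)"
    "similar_mat B (nilpotent_jordan ls)" "A * B = B * A"
    using assms by (auto simp: commuting_types_def)
  let ?J = "nilpotent_jordan ls :: 'a mat" and ?n = "sum_list ls"
  obtain P Q where cs: "B \<in> carrier_mat ?n ?n" "P \<in> carrier_mat ?n ?n" "Q \<in> carrier_mat ?n ?n"
    and PQ: "P * Q = 1\<^sub>m ?n" and QP: "Q * P = 1\<^sub>m ?n" and J: "Q * B = ?J * Q" "B * P = P * ?J"
    by (rule similar_mat_intertwiners[OF AB(2) nilpotent_jordan_carrier(1)])
  \<comment> \<open>The size of \<open>A\<close> comes from \<open>A * B = B * A\<close>, whose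
    sides have the row counts of \<open>A\<close> and of \<open>B\<close>.\<close>
  have "dim_row A = dim_row (A * B)" "dim_row (B * A) = dim_row B" by simp_all
  moreover obtain m where "A \<in> carrier_mat m m" using similar_matD[OF AB(1)] by auto
  ultimately have A: "A \<in> carrier_mat ?n ?n" using cs AB(3) by auto
  note assoc = assoc_mult_mat[of _ ?n ?n _ ?n _ ?n] mult_carrier_mat[of _ ?n ?n _ ?n]
    nilpotent_jordan_carrier(1)
  have "(Q * A * P) * ?J = Q * (A * (P * ?J))" using cs A by (simp only: assoc)
  also have "\<dots> = Q * ((A * B) * P)" using cs A by (simp only: assoc flip: J(2))
  also have "\<dots> = (Q * B) * (A * P)" using cs A by (simp only: AB(3) assoc)
  also have "\<dots> = ?J * (Q * A * P)" using cs A by (simp only: J(1) assoc)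
  finally have "(Q * A * P) * ?J = ?J * (Q * A * P)" .
  moreover have "similar_mat (Q * A * P) A"
    by (rule similar_matI[OF _ QP PQ]) (use cs A in auto)
  ultimately show thesis
    using that AB(1) similar_mat_trans by blast
qed

section \<open>Detecting parts 1, parts at least 3, and eigenvalues\<close>

text \<open>An algebraic form of the absence of parts 1 that is inherited by direct sums: \<open>J X + Y J = 1\<close>
  makes \<open>f g\<close> vanish whenever \<open>f J = 0\<close> and \<open>J g = 0\<close>.\<close>

lemma nilpotent_jordan_splitting:
  assumes "\<forall>k\<in>set ks. 2 \<le> k" "n = sum_list ks"
  shows "\<exists>X\<in>carrier_mat n n. \<exists>Y\<in>carrier_mat n n.
    nilpotent_jordan ks * X + Y * nilpotent_jordan ks = (1\<^sub>m n :: 'a::field mat)"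
  using assms
proof (induct ks arbitrary: n)
  case Nil
  then show ?case by (auto intro!: bexI[of _ "0\<^sub>m 0 0"])
next
  case (Cons k ks)
  define m where "m = sum_list ks"
  obtain X Y :: "'a mat" where XY: "X \<in> carrier_mat m m" "Y \<in> carrier_mat m m"
    "nilpotent_jordan ks * X + Y * nilpotent_jordan ks = 1\<^sub>m m"
    using Cons by (auto simp: m_def)
  define k' where "k' = k - 2"
  then have k: "k = Suc (Suc k')" using Cons.prems by auto
  \<comment> \<open>\<open>jordan_block k 0 * L\<close> lacks only the last diagonal entry of the
    identity, and \<open>E * jordan_block k 0\<close> is exactly that entry. Column
    \<open>k'\<close> of \<open>E\<close> exists because \<open>2 \<le> k\<close>.\<close>
  define L :: "'a mat" where "L = mat k k (\<lambda>(i, j). if i = Suc j then 1 else 0)"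
  define E :: "'a mat" where "E = mat k k (\<lambda>(i, j). if i = Suc k' \<and> j = k' then 1 else 0)"
  have LE: "L \<in> carrier_mat k k" "E \<in> carrier_mat k k"
    by (simp_all add: L_def E_def)
  have J: "jordan_block k 0 = (shift_mat 1 k k 1 :: 'a mat)"
    by (rule eq_matI) auto
  have "E * jordan_block k 0 = mat k k (\<lambda>(i, j). if i = Suc k' \<and> j = Suc k' then 1 else 0)"
  proof (rule eq_matI, goal_cases)
    case (1 i j)
    then have "(E * jordan_block k 0) $$ (i, j) =
        (\<Sum>l<k. (if l = k' then 1 else 0) * (if i = Suc k' \<and> j = Suc l then 1 else 0))"
      using LE by (auto simp: E_def scalar_prod_def atLeast0LessThan intro!: sum.cong)
    with 1 show ?case by (simp add: sum_delta_mult k)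
  qed (use LE in auto)
  then have block: "jordan_block k 0 * L + E * jordan_block k 0 = 1\<^sub>m k"
    unfolding J by (subst shift_mat_mult[OF LE(1)]) (auto simp: L_def k intro!: eq_matI)
  have NJ: "nilpotent_jordan ks \<in> carrier_mat m m" by (simp add: m_def)
  have "nilpotent_jordan (k # ks) * direct_sum L X + direct_sum E Y * nilpotent_jordan (k # ks) =
      direct_sum (jordan_block k 0 * L + E * jordan_block k 0)
        (nilpotent_jordan ks * X + Y * nilpotent_jordan ks)"
    unfolding nilpotent_jordan_Cons direct_sum_mult[OF jordan_block_carrier NJ LE(1) XY(1)]
      direct_sum_mult[OF LE(2) XY(2) jordan_block_carrier NJ]
    by (rule direct_sum_add[OF mult_carrier_mat[OF jordan_block_carrier LE(1)] mult_carrier_mat[OF NJ XY(1)]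
        mult_carrier_mat[OF LE(2) jordan_block_carrier] mult_carrier_mat[OF XY(2) NJ]])
  also have "\<dots> = 1\<^sub>m (k + m)"
    unfolding block XY(3) by (simp add: direct_sum_def)
  finally have "nilpotent_jordan (k # ks) * direct_sum L X + direct_sum E Y * nilpotent_jordan (k # ks) = 1\<^sub>m (k + m)" .
  moreover have "n = k + m" using Cons.prems(2) by (simp add: m_def)
  ultimately show ?case
    using direct_sum_carrier[OF LE(1) XY(1)] direct_sum_carrier[OF LE(2) XY(2)] by blast
qed

text \<open>The vectors \<open>F * P\<close> and \<open>Q * G\<close> are killed by
  \<open>?J\<close> and have the same product as \<open>F\<close> and \<open>G\<close>. With
  \<open>?J * X + Y * ?J\<close> inserted between them, each summand dies on one side.\<close>

lemma parts_ge_2_kernel_pairing: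
  fixes B :: "'a::field mat"
  assumes B: "similar_mat B (nilpotent_jordan ks)" "\<forall>k\<in>set ks. 2 \<le> k" "n = sum_list ks"
    and f: "\<And>j. j < n \<Longrightarrow> (\<Sum>i<n. f i * B $$ (i, j)) = 0"
    and g: "\<And>i. i < n \<Longrightarrow> (\<Sum>j<n. B $$ (i, j) * g j) = 0"
  shows "(\<Sum>i<n. f i * g i) = 0"
proof -
  let ?J = "nilpotent_jordan ks :: 'a mat"
  have J: "?J \<in> carrier_mat n n" using B(3) by simp
  obtain P Q where cs: "B \<in> carrier_mat n n" "?J \<in> carrier_mat n n" "P \<in> carrier_mat n n" "Q \<in> carrier_mat n n"
    and PQ: "P * Q = 1\<^sub>m n" and JQ: "Q * B = ?J * Q" "B * P = P * ?J"
    using similar_mat_intertwiners[OF B(1) J] J by metis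
  obtain X Y :: "'a mat" where XY: "X \<in> carrier_mat n n" "Y \<in> carrier_mat n n"
    "?J * X + Y * ?J = 1\<^sub>m n"
    using nilpotent_jordan_splitting[OF B(2,3), where 'a = 'a] by auto
  define F G where "F = mat 1 n (\<lambda>(i, j). f j)" and "G = mat n 1 (\<lambda>(i, j). g i)"
  have FG: "F \<in> carrier_mat 1 n" "G \<in> carrier_mat n 1" by (simp_all add: F_def G_def)
  have FB: "F * B = 0\<^sub>m 1 n"
    using f cs by (intro eq_matI) (auto simp: F_def scalar_prod_def atLeast0LessThan)
  have BG: "B * G = 0\<^sub>m n 1"
    using g cs by (intro eq_matI) (auto simp: G_def scalar_prod_def atLeast0LessThan)
  have "F * P * ?J = F * (P * ?J)" "?J * (Q * G) = ?J * Q * G"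
    using FG cs by (simp_all only: assoc_mult_mat[of _ 1 n _ n _ n] assoc_mult_mat[of _ n n _ n _ 1])
  then have zero: "F * P * ?J = 0\<^sub>m 1 n" "?J * (Q * G) = 0\<^sub>m n 1"
    using FG cs by (simp_all flip: JQ add: assoc_mult_mat[of _ n n _ n _ 1] BG
      assoc_mult_mat[of _ 1 n _ n _ n, symmetric] FB)
  have FP: "F * P \<in> carrier_mat 1 n" and QG: "Q * G \<in> carrier_mat n 1"
    using FG cs by auto
  have "F * G = F * P * (Q * G)"
  proof -
    have "F * P * (Q * G) = F * (P * Q * G)"
      using FG cs by (simp add: assoc_mult_mat[of _ 1 n _ n _ 1] assoc_mult_mat[of _ n n _ n _ 1])
    then show ?thesis using FG by (simp add: PQ)
  qed
  also have "\<dots> = F * P * ((?J * X + Y * ?J) * (Q * G))"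
    by (simp only: XY(3) left_mult_one_mat[OF QG])
  also have "\<dots> = F * P * (?J * X * (Q * G)) + F * P * (Y * ?J * (Q * G))"
    using FP QG XY(1,2) cs
    by (subst add_mult_distrib_mat[of _ n n _ _ 1], simp_all) (rule mult_add_distrib_mat[of _ 1 n _ 1], auto)
  also have "F * P * (?J * X * (Q * G)) = F * P * ?J * (X * (Q * G))"
    using FP QG XY cs by (simp add: assoc_mult_mat[of _ n n _ n _ 1] assoc_mult_mat[of _ 1 n _ n _ 1])
  also have "\<dots> = 0\<^sub>m 1 1"
    unfolding zero using QG XY FG by auto
  also have "Y * ?J * (Q * G) = Y * (?J * (Q * G))"
    using XY cs QG by (simp add: assoc_mult_mat[of _ n n _ n _ 1])
  also have "F * P * (Y * (?J * (Q * G))) = 0\<^sub>m 1 1"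
    by (simp only: zero right_mult_zero_mat[OF XY(2)] right_mult_zero_mat[OF FP])
  finally have "(F * G) $$ (0, 0) = 0" by simp
  then show ?thesis
    by (simp add: F_def G_def scalar_prod_def atLeast0LessThan)
qed

text \<open>A block of size 1, moved to the front, gives \<open>?J\<close> a zero row and a zero
  column at index 0. Row 0 of \<open>Q\<close> and column 0 of \<open>P\<close> carry this over to
  \<open>B\<close>.\<close>

lemma part_1_kernel_pairing:
  fixes B :: "'a::field mat"
  assumes B: "similar_mat B (nilpotent_jordan ks)" "1 \<in> set ks" "n = sum_list ks"
  obtains f g where "\<And>j. j < n \<Longrightarrow> (\<Sum>i<n. f i * B $$ (i, j)) = 0"
    "\<And>i. i < n \<Longrightarrow> (\<Sum>j<n. B $$ (i, j) * g j) = 0" "(\<Sum>i<n. f i * g i) \<noteq> 0"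
proof -
  obtain us vs where ks: "ks = us @ 1 # vs" using B(2) by (meson split_list)
  define rest where "rest = us @ vs"
  have rest: "mset ks = mset (1 # rest)" by (simp add: ks rest_def)
  let ?J = "nilpotent_jordan (1 # rest) :: 'a mat"
  have n: "n = Suc (sum_list rest)"
    using B(3) by (simp add: ks rest_def)
  have "similar_mat B ?J"
    using B(1) nilpotent_jordan_mset[OF rest] by (rule similar_mat_trans)
  then obtain P Q where cs: "B \<in> carrier_mat n n" "P \<in> carrier_mat n n" "Q \<in> carrier_mat n n"
    and QP: "Q * P = 1\<^sub>m n" and JQ: "Q * B = ?J * Q" "B * P = P * ?J"
    using nilpotent_jordan_carrier(1)[of "1 # rest", where 'a = 'a] n
    by (auto elim!: similar_mat_intertwiners[where n = n])
  have J0: "?J $$ (0, j) = 0" "?J $$ (j, 0) = 0" if "j < n" for j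
    using that n by (auto simp: nilpotent_jordan_Cons direct_sum_def)
  have n0: "0 < n" using n by simp
  show thesis
  proof (rule that[of "\<lambda>i. Q $$ (0, i)" "\<lambda>j. P $$ (j, 0)"])
    fix j assume j: "j < n"
    have "(\<Sum>i<n. Q $$ (0, i) * B $$ (i, j)) = (Q * B) $$ (0, j)"
      using cs j n0 by (auto simp: scalar_prod_def atLeast0LessThan)
    also have "\<dots> = (\<Sum>i<n. ?J $$ (0, i) * Q $$ (i, j))"
      unfolding JQ using cs j n0 by (auto simp: n scalar_prod_def atLeast0LessThan)
    also have "\<dots> = 0" by (rule sum.neutral) (simp add: J0[unfolded One_nat_def])
    finally show "(\<Sum>i<n. Q $$ (0, i) * B $$ (i, j)) = 0" .
    have "(\<Sum>i<n. B $$ (j, i) * P $$ (i, 0)) = (B * P) $$ (j, 0)"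
      using cs j n0 by (auto simp: scalar_prod_def atLeast0LessThan)
    also have "\<dots> = (\<Sum>i<n. P $$ (j, i) * ?J $$ (i, 0))"
      unfolding JQ using cs j n0 by (auto simp: n scalar_prod_def atLeast0LessThan)
    also have "\<dots> = 0" by (rule sum.neutral) (simp add: J0[unfolded One_nat_def])
    finally show "(\<Sum>i<n. B $$ (j, i) * P $$ (i, 0)) = 0" .
  next
    have "(\<Sum>i<n. Q $$ (0, i) * P $$ (i, 0)) = (Q * P) $$ (0, 0)"
      using cs n0 by (auto simp: scalar_prod_def atLeast0LessThan)
    then show "(\<Sum>i<n. Q $$ (0, i) * P $$ (i, 0)) \<noteq> 0" using n0 by (simp add: QP)
  qed
qed

text \<open>With the large block in front, the path 0, 1, 2 gives the square of \<open>?J\<close>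
  the entry 1 at position (0, 2).\<close>

lemma part_ge_3_square_nonzero:
  fixes B :: "'a::field mat"
  assumes B: "similar_mat B (nilpotent_jordan ks)" "p \<in> set ks" "3 \<le> p" "n = sum_list ks"
  obtains i j where "i < n" "j < n" "(\<Sum>l<n. B $$ (i, l) * B $$ (l, j)) \<noteq> 0"
proof -
  obtain us vs where ks: "ks = us @ p # vs" using B(2) by (meson split_list)
  define rest where "rest = us @ vs"
  have rest: "mset ks = mset (p # rest)" by (simp add: ks rest_def)
  let ?J = "nilpotent_jordan (p # rest) :: 'a mat"
  have n: "n = p + sum_list rest"
    using B(4) by (simp add: ks rest_def)
  have "similar_mat B ?J"
    using B(1) nilpotent_jordan_mset[OF rest] by (rule similar_mat_trans)
  then obtain P Q where cs: "B \<in> carrier_mat n n" "P \<in> carrier_mat n n" "Q \<in> carrier_mat n n"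
    and QP: "Q * P = 1\<^sub>m n" and JQ: "Q * B = ?J * Q" "B * P = P * ?J"
    using nilpotent_jordan_carrier(1)[of "p # rest", where 'a = 'a] n
    by (auto elim!: similar_mat_intertwiners[where n = n])
  have Jn: "?J \<in> carrier_mat n n" using nilpotent_jordan_carrier(1)[of "p # rest", where 'a = 'a] n by simp
  note assoc = assoc_mult_mat[of _ n n _ n _ n] mult_carrier_mat[of _ n n _ n]
  have "B * B \<noteq> 0\<^sub>m n n"
  proof
    assume "B * B = 0\<^sub>m n n"
    moreover have "Q * (B * B) * P = ?J * (?J * (Q * P))"
    proof -
      have "Q * (B * B) * P = (Q * B) * (B * P)" using cs by (simp only: assoc)
      also have "\<dots> = ?J * Q * (B * P)" by (simp only: JQ(1))
      also have "\<dots> = ?J * (Q * B * P)" using cs Jn by (simp only: assoc)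
      also have "\<dots> = ?J * (?J * Q * P)" by (simp only: JQ(1))
      also have "\<dots> = ?J * (?J * (Q * P))" using cs Jn by (simp only: assoc)
      finally show ?thesis .
    qed
    ultimately have zero: "?J * ?J = 0\<^sub>m n n" using cs by (simp add: QP right_mult_one_mat[OF Jn])
    have "(?J * ?J) $$ (0, 2) = (\<Sum>l<n. (if l = 1 then 1 else 0) * (if l = 1 then 1 else 0))"
      using B(3) n
      by (auto simp: scalar_prod_def atLeast0LessThan nilpotent_jordan_Cons direct_sum_def intro!: sum.cong)
    then show False using zero B(3) n by (simp add: sum_delta_mult)
  qed
  then obtain i j where "i < n" "j < n" "(B * B) $$ (i, j) \<noteq> 0"
    using cs by (metis (no_types, lifting) carrier_matD eq_matI index_mult_mat(2,3) index_zero_mat)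
  then show thesis
    using that cs by (auto simp: scalar_prod_def atLeast0LessThan)
qed

text \<open>The characteristic polynomial is a power of the indeterminate. This will make two
  diagonal entries vanish in the hook case.\<close>

lemma similar_nilpotent_jordan_eigenvalue:
  fixes B :: "'a::field mat"
  assumes B: "similar_mat B (nilpotent_jordan ks)" "n = sum_list ks"
    and g: "\<And>i. i < n \<Longrightarrow> (\<Sum>j<n. B $$ (i, j) * g j) = c * g i" "i < n" "g i \<noteq> 0"
  shows "c = 0"
proof -
  have carrier: "B \<in> carrier_mat n n"
    using similar_mat_carrier[OF B(1) nilpotent_jordan_carrier(1)] B(2) by simp
  have "eigenvector B (vec n g) c"
    unfolding eigenvector_def
  proof (intro conjI)
    show "vec n g \<noteq> 0\<^sub>v (dim_row B)"
      using g(2,3) carrier by (metis carrier_matD(1) index_vec index_zero_vec(1))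
    show "B *\<^sub>v vec n g = c \<cdot>\<^sub>v vec n g"
      using carrier g(1) by (intro eq_vecI) (auto simp: scalar_prod_def atLeast0LessThan)
  qed (use carrier in auto)
  then have "poly (char_poly B) c = 0"
    using eigenvalue_root_char_poly[OF carrier] by (auto simp: eigenvalue_def)
  moreover have "char_poly B = (\<Prod>k\<leftarrow>ks. [:0, 1:] ^ k)"
    using char_poly_similar[OF B(1)] jordan_matrix_char_poly[of "map (\<lambda>k. (k, 0 :: 'a)) ks"]
    by (simp add: nilpotent_jordan_def comp_def)
  ultimately show ?thesis
    by (auto simp: poly_prod_list prod_list_zero_iff poly_power)
qed

section \<open>Types with a part of size at least 3\<close>

text \<open>The truncated shift is a Jordan block of size \<open>M\<close> bordered by zeros, so
  \<open>M = n\<close> and \<open>n = Suc M\<close> cover both test types. Comparing entries of the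
  two products moves one step along a diagonal; repeated steps give the Toeplitz shape.\<close>

lemma commutes_truncated_shift_toeplitz:
  fixes B :: "'a::semiring_1 mat"
  assumes B: "B \<in> carrier_mat n n" and M: "M \<le> n"
    and comm: "B * mat n n (\<lambda>(i, j). if j = Suc i \<and> j < M then 1 else 0) =
      mat n n (\<lambda>(i, j). if j = Suc i \<and> j < M then 1 else 0) * B" (is "B * ?J = ?J * B")
  shows "i < n \<Longrightarrow> j < n \<Longrightarrow>
      (if Suc i < M then B $$ (Suc i, j) else 0) = (if 0 < j \<and> j < M then B $$ (i, j - 1) else 0)"
    and "i < M \<Longrightarrow> j < M \<Longrightarrow> B $$ (i, j) = (if i \<le> j then B $$ (0, j - i) else 0)"
proof -
  show step: "(if Suc i < M then B $$ (Suc i, j) else 0) = (if 0 < j \<and> j < M then B $$ (i, j - 1) else 0)"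
    if ij: "i < n" "j < n" for i j
  proof -
    have "(?J * B) $$ (i, j) = (\<Sum>k<n. (if k = Suc i then 1 else 0) * (if Suc i < M then B $$ (k, j) else 0))"
      using ij B by (auto simp: scalar_prod_def atLeast0LessThan intro!: sum.cong)
    also have "\<dots> = (if Suc i < M then B $$ (Suc i, j) else 0)"
      using M by (simp add: sum_delta_mult)
    finally have 1: "(?J * B) $$ (i, j) = (if Suc i < M then B $$ (Suc i, j) else 0)" .
    have "(B * ?J) $$ (i, j) =
        (\<Sum>k<n. (if 0 < j \<and> j < M then B $$ (i, k) else 0) * (if k = j - 1 then 1 else 0))"
      using ij B by (auto simp: scalar_prod_def atLeast0LessThan intro!: sum.cong)
    also have "\<dots> = (if 0 < j \<and> j < M then B $$ (i, j - 1) else 0)"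
      using ij by (simp add: sum_mult_delta less_imp_diff_less)
    finally show ?thesis using 1 comm by simp
  qed
  show "i < M \<Longrightarrow> j < M \<Longrightarrow> B $$ (i, j) = (if i \<le> j then B $$ (0, j - i) else 0)"
  proof (induct i arbitrary: j)
    case (Suc i)
    then show ?case using step[of i j] M by (cases j) auto
  qed simp
qed

lemma first_nonzero:
  fixes p :: "nat \<Rightarrow> 'a::zero"
  assumes "p t \<noteq> 0"
  obtains k where "k \<le> t" "p k \<noteq> 0" "\<And>s. s < k \<Longrightarrow> p s = 0"
proof (rule that[of "LEAST s. p s \<noteq> 0"])
  show "(LEAST s. p s \<noteq> 0) \<le> t" "p (LEAST s. p s \<noteq> 0) \<noteq> 0"
    using assms by (rule Least_le, rule LeastI)
qed (auto dest: not_less_Least)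

section \<open>The two obstructions: a single block, and the hook\<close>

text \<open>If \<open>k\<close> is the index of the first nonzero Toeplitz coefficient,
  \<open>f\<close> vanishes below \<open>n - k\<close> and \<open>g\<close> vanishes from
  \<open>k\<close> on, so \<open>2 * k < n\<close> leaves no index where both are nonzero.\<close>

lemma not_commuting_types_single:
  assumes "1 \<in> set ks" "p \<in> set ks" "3 \<le> p"
  shows "\<not> commuting_types TYPE('a::field) ks [sum_list ks]"
proof
  define n where "n = sum_list ks"
  assume "commuting_types TYPE('a) ks [sum_list ks]"
  then obtain B :: "'a mat" where sim: "similar_mat B (nilpotent_jordan ks)"
    and comm: "B * nilpotent_jordan [n] = nilpotent_jordan [n] * B"
    unfolding n_def by (rule commuting_types_normalize)
  have B: "B \<in> carrier_mat n n"
    using similar_mat_carrier[OF sim nilpotent_jordan_carrier(1)] by (simp add: n_def)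
  have J: "nilpotent_jordan [n] = mat n n (\<lambda>(i, j). if j = Suc i \<and> j < n then 1 else 0)"
    by (rule eq_matI) (auto simp: nilpotent_jordan_singleton)
  define b where "b t = B $$ (0, t)" for t
  have toeplitz: "B $$ (i, j) = (if i \<le> j then b (j - i) else 0)" if "i < n" "j < n" for i j
    using commutes_truncated_shift_toeplitz(2)[OF B le_refl comm[unfolded J] that] by (simp only: b_def)
  obtain i j where ij: "i < n" "j < n" "(\<Sum>l<n. B $$ (i, l) * B $$ (l, j)) \<noteq> 0"
    by (rule part_ge_3_square_nonzero[OF sim assms(2,3) n_def])
  then obtain l where l: "l < n" "B $$ (i, l) \<noteq> 0" "B $$ (l, j) \<noteq> 0"
    by (auto elim!: sum.not_neutral_contains_not_neutral)
  then have "b (l - i) \<noteq> 0" using toeplitz ij by (auto split: if_splits)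
  then obtain k where k: "b k \<noteq> 0" "\<And>s. s < k \<Longrightarrow> b s = 0"
    using first_nonzero[of b] by blast
  \<comment> \<open>A nonzero term of the square is a path from \<open>i\<close> over
    \<open>l\<close> to \<open>j\<close> with both steps at least \<open>k\<close>.\<close>
  have "i \<le> l" "b (l - i) \<noteq> 0" "l \<le> j" "b (j - l) \<noteq> 0"
    using toeplitz[of i l] toeplitz[of l j] l ij by (auto split: if_splits)
  then have "i \<le> l" "k \<le> l - i" "l \<le> j" "k \<le> j - l"
    using k(2) by (auto simp: not_less[symmetric])
  then have "2 * k < n" using ij by simp
  obtain f g where f: "\<And>j. j < n \<Longrightarrow> (\<Sum>i<n. f i * B $$ (i, j)) = 0"
    and g: "\<And>i. i < n \<Longrightarrow> (\<Sum>j<n. B $$ (i, j) * g j) = 0" and fg: "(\<Sum>i<n. f i * g i) \<noteq> 0"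
    using part_1_kernel_pairing[OF sim assms(1) n_def] by blast
  \<comment> \<open>In column \<open>i + k\<close>, rows after \<open>i\<close> meet only zero
    entries, and \<open>f\<close> is already known to vanish before \<open>i\<close>. For
    \<open>g\<close>, row \<open>j - k\<close> is used in the same way from the last index
    downwards.\<close>
  have f0: "f i = 0" if "i + k < n" for i
    using that
  proof (induct i rule: less_induct)
    case (less i)
    have "f l * B $$ (l, i + k) = (if l = i then f i * b k else 0)" if "l < n" for l
      using that less toeplitz[of l "i + k"] k(2)[of "i + k - l"] by (cases l i rule: linorder_cases) auto
    then have "(\<Sum>l<n. f l * B $$ (l, i + k)) = (\<Sum>l<n. if l = i then f i * b k else 0)"
      by (intro sum.cong) auto
    then show ?case using f[of "i + k"] less.prems k(1) by simp
  qed
  have g0: "g j = 0" if "k \<le> j" "j < n" for j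
    using that
  proof (induct "n - j" arbitrary: j rule: less_induct)
    case less
    have "B $$ (j - k, l) * g l = (if l = j then b k * g j else 0)" if "l < n" for l
      using that less.prems less.hyps[of l] toeplitz[of "j - k" l] k(2)[of "l - (j - k)"]
      by (cases l j rule: linorder_cases) auto
    then have "(\<Sum>l<n. B $$ (j - k, l) * g l) = (\<Sum>l<n. if l = j then b k * g j else 0)"
      by (intro sum.cong) auto
    then show ?case using g[of "j - k"] less.prems k(1) by simp
  qed
  obtain i where "i < n" "f i * g i \<noteq> 0"
    using fg by (auto elim!: sum.not_neutral_contains_not_neutral)
  then have "n \<le> i + k" "i < k" using f0[of i] g0[of i] by (auto simp: not_less[symmetric])
  then show False using \<open>2 * k < n\<close> by simp
qed

text \<open>Outside its Toeplitz square, \<open>B\<close> has at most \<open>a\<close> at the top of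
  the last column, \<open>b\<close> in the last row at \<open>M - 1\<close>, and a corner entry,
  which turns out to be 0. The vanishing of the pairing forces \<open>M - 1 = 2 * k\<close> and
  \<open>a * b = - (q k * q k)\<close>, and then the square of \<open>B\<close> is zero.\<close>

lemma not_commuting_types_hook:
  assumes "\<forall>k\<in>set ks. 2 \<le> k" "p \<in> set ks" "3 \<le> p" "sum_list ks = Suc M" "3 \<le> M"
  shows "\<not> commuting_types TYPE('a::field) ks [M, 1]"
proof
  define n where "n = Suc M"
  have ks: "n = sum_list ks" using assms(4) by (simp add: n_def)
  assume "commuting_types TYPE('a) ks [M, 1]"
  then obtain B :: "'a mat" where sim: "similar_mat B (nilpotent_jordan ks)"
    and comm: "B * nilpotent_jordan [M, 1] = nilpotent_jordan [M, 1] * B"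
    by (rule commuting_types_normalize)
  have B: "B \<in> carrier_mat n n"
    using similar_mat_carrier[OF sim nilpotent_jordan_carrier(1)] by (simp add: ks)
  have J: "nilpotent_jordan [M, 1] = mat n n (\<lambda>(i, j). if j = Suc i \<and> j < M then 1 else 0)"
    by (rule eq_matI) (auto simp: nilpotent_jordan_Cons direct_sum_def n_def)
  have "M \<le> n" by (simp add: n_def)
  note step = commutes_truncated_shift_toeplitz(1)[OF B \<open>M \<le> n\<close> comm[unfolded J]]
  define q where "q t = B $$ (0, t)" for t
  define a b where "a = B $$ (0, M)" and "b = B $$ (M, M - 1)"
  have toeplitz: "B $$ (i, j) = (if i \<le> j then q (j - i) else 0)" if "i < M" "j < M" for i j
    using commutes_truncated_shift_toeplitz(2)[OF B \<open>M \<le> n\<close> comm[unfolded J] that] by (simp only: q_def)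
  have col: "B $$ (i, M) = (if i = 0 then a else 0)" if "i < M" for i
    using step[of "i - 1" M] that by (auto simp: a_def n_def)
  have row: "B $$ (M, j) = (if j = M - 1 then b else 0)" if "j < M" for j
  proof (cases "j = M - 1")
    case False
    then have "Suc j < M" using that by simp
    then show ?thesis using step[of M "Suc j"] False by (simp add: n_def)
  qed (simp add: b_def)
  have sum_n: "(\<Sum>i<n. h i) = (\<Sum>i<M. h i) + h M" for h :: "nat \<Rightarrow> 'a"
    by (simp add: n_def)
  have sum_two: "(\<Sum>i<n. ((if i = x then c else 0) + (if i = y then d else 0)) * h i) = c * h x + d * h y"
    "(\<Sum>i<n. h i * ((if i = x then c else 0) + (if i = y then d else 0))) = h x * c + h y * d"
    if "x < n" "y < n" for x y c d and h :: "nat \<Rightarrow> 'a"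
    using that
    by (simp_all add: distrib_left distrib_right sum.distrib if_distrib[of "\<lambda>x. x * _"]
        if_distrib[of "\<lambda>x. _ * x"] cong: if_cong)
  \<comment> \<open>The first basis vector is an eigenvector with eigenvalue
    \<open>q 0\<close>.\<close>
  have q0: "q 0 = 0"
  proof (rule similar_nilpotent_jordan_eigenvalue[OF sim ks])
    fix i assume "i < n"
    then have "B $$ (i, 0) = q 0 * (if i = 0 then 1 else 0)"
      using toeplitz[of i 0] row[of 0] assms(5) by (cases "i = M") (auto simp: n_def)
    then show "(\<Sum>j<n. B $$ (i, j) * (if j = 0 then 1 else 0)) = q 0 * (if i = 0 then 1 else 0)"
      by (simp add: sum_mult_delta n_def)
  qed (simp_all add: n_def)
  \<comment> \<open>Column 0 is now zero, so if \<open>?d\<close> were nonzero, the last column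
    itself would be an eigenvector for \<open>?d\<close>.\<close>
  have corner: "B $$ (M, M) = 0" (is "?d = 0")
  proof (rule ccontr)
    assume d: "?d \<noteq> 0"
    have "?d = 0"
    proof (rule similar_nilpotent_jordan_eigenvalue[OF sim ks])
      fix i assume "i < n"
      then have "B $$ (i, 0) * a + B $$ (i, M) * ?d = ?d * ((if i = 0 then a else 0) + (if i = M then ?d else 0))"
        using toeplitz[of i 0] row[of 0] col[of i] q0 assms(5) by (cases "i = M") (auto simp: n_def)
      then show "(\<Sum>j<n. B $$ (i, j) * ((if j = 0 then a else 0) + (if j = M then ?d else 0))) =
          ?d * ((if i = 0 then a else 0) + (if i = M then ?d else 0))"
        by (subst sum_two) (simp_all add: n_def)
    next
      show "(if M = 0 then a else 0) + (if M = M then ?d else 0) \<noteq> 0" using d assms(5) by simp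
    qed (simp add: n_def)
    with d show False by simp
  qed
  show False
  proof (cases "\<exists>t<M - 1. q t \<noteq> 0")
    case False
    \<comment> \<open>Only \<open>q (M - 1)\<close>, \<open>a\<close> and \<open>b\<close> can be
      nonzero here, and \<open>3 \<le> M\<close> keeps \<open>u\<close> away from the rows and
      columns of all three. The basis vector at \<open>u\<close> is thus killed on both sides but
      pairs to 1 with itself.\<close>
    define u where "u = M - 2"
    have u: "u < M" "0 < u" "u < M - 1" using assms(5) by (auto simp: u_def)
    have "B $$ (i, u) = 0 \<and> B $$ (u, i) = 0" if "i < n" for i
    proof (cases "i = M")
      case True
      then show ?thesis using row[of u] col[of u] u by simp
    next
      case i: False
      then have "i < M" using that by (simp add: n_def)
      moreover from this have "u - i < M - 1" "i - u < M - 1" using assms(5) u by simp_all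
      then have "q (u - i) = 0" "q (i - u) = 0" using False by blast+
      ultimately show ?thesis using toeplitz u(1) q0 by simp
    qed
    moreover have "u < n" using u(1) by (simp add: n_def)
    ultimately have zero: "(\<Sum>i<n. (if i = u then 1 else 0) * B $$ (i, j)) = 0"
      "(\<Sum>i<n. B $$ (j, i) * (if i = u then 1 else 0)) = 0" if "j < n" for j
      using that unfolding sum_delta_mult sum_mult_delta by simp_all
    have "(\<Sum>i<n. (if i = u then 1 else 0) * (if i = u then 1 else 0 :: 'a)) = 0"
      by (rule parts_ge_2_kernel_pairing[OF sim assms(1) ks zero])
    then show False using u by (simp add: sum_delta_mult n_def)
  next
    case True
    then obtain t where t: "t < M - 1" "q t \<noteq> 0" by blast
    obtain k where "k \<le> t" and k: "q k \<noteq> 0" "\<And>s. s < k \<Longrightarrow> q s = 0"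
      using first_nonzero[of q, OF t(2)] by blast
    with t(1) have k: "k < M - 1" "q k \<noteq> 0" "\<And>s. s < k \<Longrightarrow> q s = 0" by auto
    have "0 < k" using q0 k(2) by (cases k) auto
    \<comment> \<open>Row \<open>s\<close> has \<open>q k\<close> in column \<open>M - 1\<close>,
      the place of \<open>b\<close> in the last row; column \<open>k\<close> has \<open>q k\<close>
      in row 0, the place of \<open>a\<close> in the last column. Hence \<open>f\<close> and
      \<open>g\<close> eliminate \<open>b\<close> and \<open>a\<close>.\<close>
    define s where "s = M - 1 - k"
    have s: "0 < s" "s < M" "s + k = M - 1" using k(1) by (auto simp: s_def)
    have lt: "M < n" "s < n" "k < n" using s k(1) by (simp_all add: n_def)
    define f g where "f i = (if i = M then 1 else 0) + (if i = s then - b / q k else 0)"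
      and "g i = (if i = M then 1 else 0) + (if i = k then - a / q k else 0)" for i
    have "(\<Sum>i<n. f i * g i) = 0"
    proof (rule parts_ge_2_kernel_pairing[OF sim assms(1) ks])
      fix j assume j: "j < n"
      have "B $$ (M, j) + (- b / q k) * B $$ (s, j) = 0"
      proof (cases "j = M")
        case True
        then show ?thesis using corner col s by simp
      next
        case False
        then have "j < M" using j by (simp add: n_def)
        show ?thesis
        proof (cases "j = M - 1")
          case True
          then have "s \<le> j" "j - s = k" using s by simp_all
          then show ?thesis using toeplitz[OF s(2) \<open>j < M\<close>] row[OF \<open>j < M\<close>] True k(2) by simp
        next
          case False
          \<comment> \<open>For \<open>j < s\<close> the truncated difference is 0, still below
            \<open>k\<close>.\<close>
          then have "j - s < k" using \<open>j < M\<close> s(3) \<open>0 < k\<close> by arith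
          then show ?thesis using toeplitz[OF s(2) \<open>j < M\<close>] row[OF \<open>j < M\<close>] False k(3) by simp
        qed
      qed
      then show "(\<Sum>i<n. f i * B $$ (i, j)) = 0"
        by (simp only: f_def sum_two(1)[OF lt(1,2)] mult_1)
    next
      fix i assume i: "i < n"
      have "B $$ (i, M) + B $$ (i, k) * (- a / q k) = 0"
      proof (cases "i = M")
        case True
        then show ?thesis using corner row[of k] k(1) by simp
      next
        case False
        then have "i < M" "k < M" using i k(1) by (simp_all add: n_def)
        then show ?thesis
          using toeplitz[of i k] col[of i] k(2) k(3)[of "k - i"] by (cases "i = 0") simp_all
      qed
      then show "(\<Sum>j<n. B $$ (i, j) * g j) = 0"
        by (simp only: g_def sum_two(2)[OF lt(1,3)] mult_1_right)
    qed
    then have "g M + (- b / q k) * g s = 0"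
      by (simp only: f_def sum_two(1)[OF lt(1,2)] mult_1)
    \<comment> \<open>The pairing is 1 if \<open>s\<close> and \<open>k\<close> differ, and
      \<open>1 + a * b / (q k * q k)\<close> if they agree.\<close>
    then have "s = k" and ab: "a * b = - (q k * q k)"
      using s k(1,2) by (auto simp: g_def field_simps eq_neg_iff_add_eq_0 split: if_splits)
    \<comment> \<open>Only two paths of length two can contribute, both from 0 to
      \<open>M - 1\<close>: over \<open>k\<close> with weight \<open>q k * q k\<close> and over
      \<open>M\<close> with weight \<open>a * b\<close>. They cancel.\<close>
    have "(\<Sum>l<n. B $$ (i, l) * B $$ (l, j)) = 0" if ij: "i < n" "j < n" for i j
    proof -
      consider "i < M" "j < M" | "i < M" "j = M" | "i = M" using ij by (auto simp: n_def less_Suc_eq)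
      then show ?thesis
      proof cases
        case 1
        have "B $$ (i, l) * B $$ (l, j) = (if l = k then if i = 0 \<and> j = M - 1 then q k * q k else 0 else 0)"
          if "l < M" for l
        proof (cases "l = k \<and> i = 0 \<and> j = M - 1")
          case True
          then have "l - i = k" "j - l = k" "i \<le> l" "l \<le> j" using s(3) \<open>s = k\<close> by simp_all
          then show ?thesis using toeplitz[OF 1(1) that] toeplitz[OF that 1(2)] True by simp
        next
          case False
          have "B $$ (i, l) = 0 \<or> B $$ (l, j) = 0"
          proof (rule ccontr)
            assume "\<not> ?thesis"
            then have "i \<le> l" "q (l - i) \<noteq> 0" "l \<le> j" "q (j - l) \<noteq> 0"
              using toeplitz[OF 1(1) that] toeplitz[OF that 1(2)] by (simp_all split: if_splits)
            then have "i \<le> l" "k \<le> l - i" "l \<le> j" "k \<le> j - l"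
              using k(3) by (auto simp: not_less[symmetric])
            then show False using 1 s(3) \<open>s = k\<close> False by arith
          qed
          with False show ?thesis by auto
        qed
        then have "(\<Sum>l<M. B $$ (i, l) * B $$ (l, j)) = (if i = 0 \<and> j = M - 1 then q k * q k else 0)"
          using s \<open>s = k\<close> by simp
        then show ?thesis using 1 ab by (simp add: sum_n col row)
      next
        case 2
        have "B $$ (i, l) * B $$ (l, j) = 0" if "l < M" for l
          using that 2 col[of l] toeplitz[of i 0] q0 by auto
        then have "(\<Sum>l<M. B $$ (i, l) * B $$ (l, j)) = 0"
          by (intro sum.neutral ballI) (simp only: lessThan_iff)
        then show ?thesis using 2 corner by (simp add: sum_n)
      next
        case 3
        have "B $$ (i, l) * B $$ (l, j) = 0" if "l < M" for l
        proof (cases "l = M - 1")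
          case True
          have "B $$ (l, j) = 0"
          proof (cases "j = M")
            case True
            then show ?thesis using col[OF that] \<open>l = M - 1\<close> assms(5) by simp
          next
            case False
            then have "j < M" using ij(2) by (simp add: n_def)
            then show ?thesis using toeplitz[OF that \<open>j < M\<close>] \<open>l = M - 1\<close> q0 by simp
          qed
          then show ?thesis by simp
        next
          case False
          then show ?thesis using 3 row[OF that] by simp
        qed
        then have "(\<Sum>l<M. B $$ (i, l) * B $$ (l, j)) = 0"
          by (intro sum.neutral ballI) (simp only: lessThan_iff)
        then show ?thesis using 3 corner by (simp add: sum_n)
      qed
    qed
    then show False
      using part_ge_3_square_nonzero[OF sim assms(2,3) ks] by metis
  qed
qed

section \<open>From lists with parts 2 and 1 to partitions, and the classification\<close>

lemma parts_le_2_cases: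
  fixes ks :: "nat list"
  assumes "\<forall>p\<in>set ks. 0 < p \<and> p \<le> 2"
  obtains a b where "mset ks = mset (replicate a 2 @ replicate b 1)"
proof -
  have "\<exists>a b. mset ks = mset (replicate a 2 @ replicate b 1)"
    using assms
  proof (induct ks)
    case Nil
    show ?case by (intro exI[of _ 0]) simp
  next
    case (Cons k ks)
    then obtain a b where ab: "mset ks = mset (replicate a 2 @ replicate b 1)" by auto
    have "k = 2 \<or> k = 1" using Cons.prems by (auto simp: le_Suc_eq numeral_2_eq_2)
    then show ?case
    proof
      assume "k = 2"
      then show ?thesis using ab by (intro exI[of _ "Suc a"] exI[of _ b]) simp
    next
      assume "k = 1"
      then show ?thesis using ab by (intro exI[of _ a] exI[of _ "Suc b"]) simp
    qed
  qed
  then show thesis using that by blast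
qed

lemma commuting_types_parts_le_2:
  assumes "\<forall>p\<in>set ks. 0 < p \<and> p \<le> 2" "sum_list ks = sum_list ls"
  shows "commuting_types TYPE('a::field) ks ls"
proof -
  obtain a b where ab: "mset ks = mset (replicate a 2 @ replicate b 1)"
    using assms(1) by (rule parts_le_2_cases)
  have "sum_list ks = 2 * a + b"
    using ab by (metis sum_mset_sum_list sum_list_append sum_list_replicate mult.commute mult_1 id_apply of_nat_eq_id)
  then show ?thesis
    using commuting_types_mset[OF commuting_types_twos_ones[of a b ls] ab[symmetric] refl] assms(2) by simp
qed

lemma commuting_types_sym: "commuting_types K ks ls \<Longrightarrow> commuting_types K ls ks"
  unfolding commuting_types_def by metis

lemma commuting_types_refl: "commuting_types TYPE('a::field) ks ks"
  unfolding commuting_types_def using similar_mat_refl nilpotent_jordan_carrier(1) by blast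

theorem theorem4p6:
  fixes n :: nat and lam :: "nat list"
  assumes "is_partition n lam"
  shows "universal TYPE('k::field) n lam \<longleftrightarrow> (\<forall>p\<in>set lam. p \<le> 2) \<or> lam = [3]"
proof -
  have lam: "\<forall>k\<in>set lam. 0 < k" "sum_list lam = n" "sorted_wrt (\<ge>) lam"
    using assms by (auto simp: is_partition_def)
  have universal: "universal TYPE('k) n lam \<longleftrightarrow>
      (\<forall>mu. is_partition n mu \<longrightarrow> commuting_types TYPE('k) lam mu)"
    using assms lam(1) by (auto simp: universal_def is_partition_def classes_commute_iff)
  show ?thesis
  proof
    assume "(\<forall>p\<in>set lam. p \<le> 2) \<or> lam = [3]"
    then show "universal TYPE('k) n lam"
      unfolding universal
    proof (elim disjE, intro allI impI)
      fix mu assume "\<forall>p\<in>set lam. p \<le> 2" "is_partition n mu"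
      then show "commuting_types TYPE('k) lam mu"
        using lam by (intro commuting_types_parts_le_2) (auto simp: is_partition_def)
    next
      \<comment> \<open>Any other partition of 3 has all parts at most 2, and commuting is
        symmetric.\<close>
      assume three: "lam = [3]"
      show "\<forall>mu. is_partition n mu \<longrightarrow> commuting_types TYPE('k) lam mu"
      proof (intro allI impI)
        fix mu assume mu: "is_partition n mu"
        show "commuting_types TYPE('k) lam mu"
        proof (cases "\<forall>p\<in>set mu. p \<le> 2")
          case True
          then show ?thesis
            using mu lam by (intro commuting_types_sym[OF commuting_types_parts_le_2]) (auto simp: is_partition_def)
        next
          case False
          then obtain p us vs where p: "mu = us @ p # vs" "3 \<le> p"
            by (metis split_list not_less_eq_eq numeral_2_eq_2 numeral_3_eq_3)
          have pos: "\<forall>k\<in>set mu. 0 < k" "sum_list us + p + sum_list vs = 3"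
            using mu p three lam(2) by (auto simp: is_partition_def)
          have "us = []" using pos p by (cases us) auto
          moreover have "vs = []" using pos p by (cases vs) auto
          ultimately show ?thesis using p pos three by (auto intro: commuting_types_refl)
        qed
      qed
    qed
  next
    assume uni: "universal TYPE('k) n lam"
    show "(\<forall>p\<in>set lam. p \<le> 2) \<or> lam = [3]"
    proof (rule ccontr)
      assume contra: "\<not> ((\<forall>p\<in>set lam. p \<le> 2) \<or> lam = [3])"
      then obtain p where p: "p \<in> set lam" "3 \<le> p" by auto
      then have "3 \<le> n" using lam(2) member_le_sum_list[of p lam] by simp
      show False
      proof (cases "1 \<in> set lam")
        case True
        have "is_partition n [n]" using \<open>3 \<le> n\<close> by (simp add: is_partition_def)
        then show False
          using not_commuting_types_single[OF True p, where 'a = 'k] uni universal lam(2) by metis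
      next
        case False
        have ge_2: "\<forall>k\<in>set lam. 2 \<le> k"
          using lam(1) False by (metis One_nat_def Suc_leI le_neq_implies_less numeral_2_eq_2)
        \<comment> \<open>For \<open>n = 3\<close> the part \<open>p\<close> would be the whole
          partition. Hence \<open>n\<close> is at least 4, as the hook \<open>[M, 1]\<close> with
          \<open>3 \<le> M\<close> demands.\<close>
        have "n \<noteq> 3"
        proof
          assume "n = 3"
          obtain us vs where us: "lam = us @ p # vs" using p(1) by (meson split_list)
          have "us = []" using us lam(1,2) p \<open>n = 3\<close> by (cases us) auto
          moreover have "vs = []" using us lam(1,2) p \<open>n = 3\<close> by (cases vs) auto
          ultimately show False using us lam(2) \<open>n = 3\<close> contra by auto
        qed
        then obtain M where M: "n = Suc M" "3 \<le> M"
          using \<open>3 \<le> n\<close> by (cases n) auto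
        have "is_partition n [M, 1]" using M by (simp add: is_partition_def)
        then show False
          using not_commuting_types_hook[OF ge_2 p _ M(2), where 'a = 'k] uni universal lam(2) M(1) by metis
      qed
    qed
  qed
qed

end
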